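(* Let $m,n$ be positive integers, let $l,u\in\mathbb{R}_+^m$, $l',u'\in\mathbb{R}_+^n$ and $L,U\in\mathbb{R}_+$ satisfy $u\ge l$, $u'\ge l'$, $U\ge L$, $u>0$ and $u'>0$ (all vector inequalities componentwise). Let $\tilde{\mathcal{T}}(l,u,l',u',L,U)$ be the set of all matrices $X=(x_{ij})\in\mathbb{R}_+^{m\times n}$ with $\operatorname{rank}(X)\le 1$ such that $$l_i\le \sum_{j=1}^n x_{ij}\le u_i\ (i\in[m]),\qquad l'_j\le \sum_{i=1}^m x_{ij}\le u'_j\ (j\in[n]),\qquad L\le \sum_{i=1}^m\sum_{j=1}^n x_{ij}\le U .$$ Then the convex hull $\operatorname{conv}(\tilde{\mathcal{T}}(l,u,l',u',L,U))$ is second-order cone representable.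
   Context: $[k]=\{1,\dots,k\}$ and $\mathbb{R}_+$ denotes the nonnegative reals. A set $S\subseteq\mathbb{R}^d$ is second-order cone representable if there exist $p\ge 0$ and finitely many affine maps $A_k:\mathbb{R}^d\times\mathbb{R}^p\to\mathbb{R}^{d_k+1}$ such that $S=\{x\in\mathbb{R}^d:\exists w\in\mathbb{R}^p,\ A_k(x,w)\in \mathcal{L}^{d_k+1}\text{ for all }k\}$, where $\mathcal{L}^{d+1}=\{(v,s)\in\mathbb{R}^d\times\mathbb{R}:\|v\|_2\le s\}$ is the second-order (Lorentz) cone. *)

theory Defs
  imports "HOL-Analysis.Analysis"
begin

text \<open>
  The number of auxiliary variables and the dimensions of the cones are bound inside the notion of
  representability, so these spaces are the carriers of the library's
  \<^const>\<open>Euclidean_space\<close>: sequences of reals that vanish from the given index on.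
  The ambient space of the represented set is a type of class \<^class>\<open>euclidean_space\<close>.
  A point (v, s) of the Lorentz cone in dimension d + 1 is the sequence with v in the coordinates
  0, ..., d - 1 and s in coordinate d.
\<close>

definition Lorentz_cone :: "nat \<Rightarrow> (nat \<Rightarrow> real) set" where
  "Lorentz_cone d = {y \<in> topspace (Euclidean_space (Suc d)). L2_set y {..<d} \<le> y d}"

definition affine_map ::
  "nat \<Rightarrow> nat \<Rightarrow> ('a::euclidean_space \<Rightarrow> (nat \<Rightarrow> real) \<Rightarrow> (nat \<Rightarrow> real)) \<Rightarrow> bool" where
  "affine_map p q A \<longleftrightarrow>
     (\<forall>x. \<forall>w \<in> topspace (Euclidean_space p). A x w \<in> topspace (Euclidean_space q)) \<and>
     (\<exists>(a :: nat \<Rightarrow> 'a) (b :: nat \<Rightarrow> nat \<Rightarrow> real) (c :: nat \<Rightarrow> real).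
        \<forall>x. \<forall>w \<in> topspace (Euclidean_space p). \<forall>i<q.
          A x w i = a i \<bullet> x + (\<Sum>j<p. b i j * w j) + c i)"

definition soc_representable :: "'a::euclidean_space set \<Rightarrow> bool" where
  "soc_representable S \<longleftrightarrow>
     (\<exists>(p::nat) (K::nat) (d :: nat \<Rightarrow> nat) (A :: nat \<Rightarrow> 'a \<Rightarrow> (nat \<Rightarrow> real) \<Rightarrow> (nat \<Rightarrow> real)).
        (\<forall>k<K. affine_map p (Suc (d k)) (A k)) \<and>
        S = {x. \<exists>w \<in> topspace (Euclidean_space p). \<forall>k<K. A k x w \<in> Lorentz_cone (d k)})"

definition rank_one_transport ::
  "real^'m \<Rightarrow> real^'m \<Rightarrow> real^'n \<Rightarrow> real^'n \<Rightarrow> real \<Rightarrow> real \<Rightarrow> (real^'n^'m) set" where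
  "rank_one_transport l u l' u' L U =
     {X. (\<forall>i j. 0 \<le> X $ i $ j) \<and> rank X \<le> 1 \<and>
         (\<forall>i. l $ i \<le> (\<Sum>j\<in>UNIV. X $ i $ j) \<and> (\<Sum>j\<in>UNIV. X $ i $ j) \<le> u $ i) \<and>
         (\<forall>j. l' $ j \<le> (\<Sum>i\<in>UNIV. X $ i $ j) \<and> (\<Sum>i\<in>UNIV. X $ i $ j) \<le> u' $ j) \<and>
         L \<le> (\<Sum>i\<in>UNIV. \<Sum>j\<in>UNIV. X $ i $ j) \<and> (\<Sum>i\<in>UNIV. \<Sum>j\<in>UNIV. X $ i $ j) \<le> U}"

end

theory Submission
  imports Defs
begin

text \<open>
  The set is compact, so its convex hull is the hull of the extreme points of that hull. A matrix X
  of the set with row sums a, column sums b and total s has entries a i * b j / s. If two of the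
  b j were strictly between their bounds, one could move mass between these columns in both
  directions, and likewise for rows; so at an extreme point all row sums but one and all column
  sums but one are at a bound. Once the positions and the bounds are chosen, only s is free, and X
  has the form P + s Q + (1/s) R with s in an interval. Hence the hull is the convex hull of
  finitely many affine images of arcs of the hyperbola t = 1/s. The cone over such an arc is cut
  out by s t \<ge> a^2 and linear inequalities, and sums, linear images and sections of second-order
  cone representable sets are again representable.
\<close>

section \<open>Second-order cone representable sets\<close>

text \<open>Affine functionals of a point and of the first p auxiliary variables; here, unlike in
  \<^const>\<open>affine_map\<close>, the sequence w ranges over all sequences.\<close>

definition joint_affine :: "nat \<Rightarrow> ('a::euclidean_space \<Rightarrow> (nat \<Rightarrow> real) \<Rightarrow> real) \<Rightarrow> bool" where
  "joint_affine p f \<longleftrightarrow> (\<exists>a b c. \<forall>x w. f x w = a \<bullet> x + (\<Sum>j<p. b j * w j) + c)"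

lemma joint_affineI:
  assumes "\<And>x w. f x w = a \<bullet> x + (\<Sum>j<p. b j * w j) + c"
  shows "joint_affine p f"
  using assms unfolding joint_affine_def by blast

lemma joint_affine_const: "joint_affine p (\<lambda>x w. c)"
  by (rule joint_affineI[of _ 0 "\<lambda>_. 0" p c]) simp

lemma joint_affine_inner: "joint_affine p (\<lambda>x w. a \<bullet> x)"
  by (rule joint_affineI[of _ a "\<lambda>_. 0" p 0]) simp

lemma joint_affine_coord:
  assumes "k < p"
  shows "joint_affine p (\<lambda>x w. w k)"
  by (rule joint_affineI[of _ 0 "\<lambda>j. if j = k then 1 else 0" p 0])
    (use assms in \<open>simp add: if_distrib[of "\<lambda>t. t * _"] sum.delta cong: if_cong\<close>)

lemma joint_affine_add:
  assumes "joint_affine p f" and "joint_affine p g"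
  shows "joint_affine p (\<lambda>x w. f x w + g x w)"
proof -
  obtain a b c where f: "\<And>x w. f x w = a \<bullet> x + (\<Sum>j<p. b j * w j) + c"
    using assms(1) unfolding joint_affine_def by blast
  obtain a' b' c' where g: "\<And>x w. g x w = a' \<bullet> x + (\<Sum>j<p. b' j * w j) + c'"
    using assms(2) unfolding joint_affine_def by blast
  show ?thesis
    by (rule joint_affineI[of _ "a + a'" "\<lambda>j. b j + b' j" p "c + c'"])
      (simp add: f g inner_add_left distrib_right sum.distrib)
qed

lemma joint_affine_cmult:
  assumes "joint_affine p f"
  shows "joint_affine p (\<lambda>x w. r * f x w)"
proof -
  obtain a b c where f: "\<And>x w. f x w = a \<bullet> x + (\<Sum>j<p. b j * w j) + c"
    using assms(1) unfolding joint_affine_def by blast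
  show ?thesis
    by (rule joint_affineI[of _ "r *\<^sub>R a" "\<lambda>j. r * b j" p "r * c"])
      (simp add: f distrib_left sum_distrib_left mult.assoc)
qed

lemma joint_affine_diff:
  assumes "joint_affine p f" and "joint_affine p g"
  shows "joint_affine p (\<lambda>x w. f x w - g x w)"
  using joint_affine_add[OF assms(1) joint_affine_cmult[OF assms(2), of "-1"]] by simp

lemma joint_affine_sum:
  assumes "\<And>i. i \<in> I \<Longrightarrow> joint_affine p (f i)"
  shows "joint_affine p (\<lambda>x w. \<Sum>i\<in>I. f i x w)"
  using assms
  by (induction I rule: infinite_finite_induct) (simp_all add: joint_affine_const joint_affine_add)

text \<open>Affinity is tested against every vector \<open>a\<close>, so that composing with a
  \<open>joint_affine\<close> functional needs no choice of basis.\<close>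

definition joint_affine_vec ::
    "nat \<Rightarrow> ('a::euclidean_space \<Rightarrow> (nat \<Rightarrow> real) \<Rightarrow> 'b::euclidean_space) \<Rightarrow> bool" where
  "joint_affine_vec p g \<longleftrightarrow> (\<forall>a. joint_affine p (\<lambda>x w. a \<bullet> g x w))"

text \<open>Only the first \<open>p\<close> entries of the sequence enter the formula. This is what
  allows auxiliary sequences to be truncated or concatenated later.\<close>

lemma joint_affine_cong:
  assumes "joint_affine p f" and "\<And>j. j < p \<Longrightarrow> w j = v j"
  shows "f x w = f x v"
proof -
  obtain a b c where f: "\<And>x w. f x w = a \<bullet> x + (\<Sum>j<p. b j * w j) + c"
    using assms(1) unfolding joint_affine_def by blast
  show ?thesis
    by (simp add: f assms(2))
qed

lemma joint_affine_vec_cong: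
  assumes "joint_affine_vec p g" and "\<And>j. j < p \<Longrightarrow> w j = v j"
  shows "g x w = g x v"
proof (rule euclidean_eqI)
  fix b :: 'b
  have "joint_affine p (\<lambda>x w. b \<bullet> g x w)"
    using assms(1) by (simp add: joint_affine_vec_def)
  from joint_affine_cong[OF this assms(2)] show "g x w \<bullet> b = g x v \<bullet> b"
    by (simp add: inner_commute)
qed

lemma joint_affine_compose:
  assumes "joint_affine p f" and "joint_affine_vec q g" and "\<And>j. j < p \<Longrightarrow> joint_affine q (\<lambda>x w. h x w j)"
  shows "joint_affine q (\<lambda>x w. f (g x w) (h x w))"
proof -
  obtain a b c where f: "\<And>x w. f x w = a \<bullet> x + (\<Sum>j<p. b j * w j) + c"
    using assms(1) unfolding joint_affine_def by blast
  show ?thesis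
    unfolding f using assms(2,3)
    by (intro joint_affine_add joint_affine_const joint_affine_sum joint_affine_cmult)
      (auto simp: joint_affine_vec_def)
qed

lemma joint_affine_vec_point: "joint_affine_vec p (\<lambda>x w. x)"
  by (simp add: joint_affine_vec_def joint_affine_inner)

lemma joint_affine_mono:
  assumes "joint_affine p f" and "p \<le> q"
  shows "joint_affine q f"
  using joint_affine_compose[OF assms(1) joint_affine_vec_point, of q "\<lambda>x w. w"] assms(2)
  by (simp add: joint_affine_coord)

lemma joint_affine_vec_mono:
  assumes "joint_affine_vec p f" and "p \<le> q"
  shows "joint_affine_vec q f"
  using assms joint_affine_mono unfolding joint_affine_vec_def by blast

section \<open>Lorentz cone constraints on unrestricted sequences\<close>

text \<open>A constraint is a predicate on all sequences rather than a map into
  \<open>Lorentz_cone\<close>, so constraints can be collected in a set and composed without carrier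
  conditions. The functional \<open>F d\<close> is the height in the cone.\<close>

definition cone_constraint :: "nat \<Rightarrow> ('a::euclidean_space \<Rightarrow> (nat \<Rightarrow> real) \<Rightarrow> bool) \<Rightarrow> bool" where
  "cone_constraint p c \<longleftrightarrow> (\<exists>(d::nat) F. (\<forall>i. joint_affine p (F i)) \<and>
     c = (\<lambda>x w. L2_set (\<lambda>i. F i x w) {..<d} \<le> F d x w))"

lemma cone_constraint_compose:
  assumes "cone_constraint p c" and "joint_affine_vec q g"
    and "\<And>j. j < p \<Longrightarrow> joint_affine q (\<lambda>x w. h x w j)"
  shows "cone_constraint q (\<lambda>x w. c (g x w) (h x w))"
proof -
  obtain d :: nat and F where F: "\<And>i. joint_affine p (F i)"
    and c: "c = (\<lambda>x w. L2_set (\<lambda>i. F i x w) {..<d} \<le> F d x w)"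
    using assms(1) unfolding cone_constraint_def by blast
  show ?thesis
    unfolding cone_constraint_def c
    by (rule exI[of _ d], rule exI[of _ "\<lambda>i x w. F i (g x w) (h x w)"])
      (simp add: joint_affine_compose[OF F assms(2,3)])
qed

lemma cone_constraint_cong:
  assumes "cone_constraint p c" and "\<And>j. j < p \<Longrightarrow> w j = v j"
  shows "c x w = c x v"
proof -
  obtain d :: nat and F where F: "\<And>i. joint_affine p (F i)"
    and c: "c = (\<lambda>x w. L2_set (\<lambda>i. F i x w) {..<d} \<le> F d x w)"
    using assms(1) unfolding cone_constraint_def by blast
  have "F i x w = F i x v" for i
    by (rule joint_affine_cong[OF F assms(2)])
  then show ?thesis
    by (simp add: c)
qed

lemma cone_constraint_mono:
  assumes "cone_constraint p c" and "p \<le> q"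
  shows "cone_constraint q c"
  using cone_constraint_compose[OF assms(1) joint_affine_vec_point, of q "\<lambda>x w. w"] assms(2)
  by (simp add: joint_affine_coord)

lemma cone_constraint_affine_map:
  assumes "cone_constraint p c"
  obtains d A where "affine_map p (Suc d) A"
    and "\<And>x w. w \<in> topspace (Euclidean_space p) \<Longrightarrow> A x w \<in> Lorentz_cone d \<longleftrightarrow> c x w"
proof -
  obtain d :: nat and F where F: "\<And>i. joint_affine p (F i)"
    and c: "c = (\<lambda>x w. L2_set (\<lambda>i. F i x w) {..<d} \<le> F d x w)"
    using assms(1) unfolding cone_constraint_def by blast
  obtain a b e where abe: "\<And>i x w. F i x w = a i \<bullet> x + (\<Sum>j<p. b i j * w j) + e i"
    using F unfolding joint_affine_def by metis
  \<comment> \<open>Entries after index \<open>d\<close> are set to 0 to keep the values in the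
    carrier of dimension \<open>Suc d\<close>.\<close>
  define A where "A = (\<lambda>x w i. if i < Suc d then F i x w else 0)"
  have "affine_map p (Suc d) A"
    unfolding affine_map_def topspace_Euclidean_space A_def abe
    by (rule conjI, simp, rule exI[of _ a], rule exI[of _ b], rule exI[of _ e]) simp
  moreover have "A x w \<in> Lorentz_cone d \<longleftrightarrow> c x w" for x w
  proof -
    have "L2_set (A x w) {..<d} = L2_set (\<lambda>i. F i x w) {..<d}"
      by (rule L2_set_cong) (auto simp: A_def)
    then show ?thesis
      by (auto simp: Lorentz_cone_def topspace_Euclidean_space c A_def)
  qed
  ultimately show thesis
    using that by blast
qed

lemma affine_map_cone_constraint:
  assumes "affine_map p (Suc d) A"
  obtains c where "cone_constraint p c"
    and "\<And>x w. w \<in> topspace (Euclidean_space p) \<Longrightarrow> A x w \<in> Lorentz_cone d \<longleftrightarrow> c x w"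
proof -
  obtain a b e where abe: "\<And>x w i. w \<in> topspace (Euclidean_space p) \<Longrightarrow> i < Suc d \<Longrightarrow>
      A x w i = a i \<bullet> x + (\<Sum>j<p. b i j * w j) + e i"
    using assms unfolding affine_map_def by metis
  \<comment> \<open>The affine formula extends \<open>A\<close> from the carrier to all sequences;
    the two have to agree only on the carrier and in the first \<open>Suc d\<close> entries.\<close>
  define F where "F = (\<lambda>i x w. a i \<bullet> x + (\<Sum>j<p. b i j * w j) + e i)"
  define c where "c = (\<lambda>x w. L2_set (\<lambda>i. F i x w) {..<d} \<le> F d x w)"
  have "joint_affine p (F i)" for i
    unfolding F_def by (rule joint_affineI) (rule refl)
  then have "cone_constraint p c"
    unfolding cone_constraint_def c_def by blast
  moreover have "A x w \<in> Lorentz_cone d \<longleftrightarrow> c x w" if w: "w \<in> topspace (Euclidean_space p)" for x w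
  proof -
    have "L2_set (A x w) {..<d} = L2_set (\<lambda>i. F i x w) {..<d}"
      by (rule L2_set_cong) (auto simp: F_def abe[OF w])
    moreover have "A x w \<in> topspace (Euclidean_space (Suc d))"
      using assms w unfolding affine_map_def by blast
    ultimately show ?thesis
      by (simp add: Lorentz_cone_def c_def F_def abe[OF w])
  qed
  ultimately show thesis
    using that by blast
qed

lemma soc_representable_iff:
  "soc_representable S \<longleftrightarrow>
     (\<exists>p C. finite C \<and> (\<forall>c\<in>C. cone_constraint p c) \<and> S = {x. \<exists>w. \<forall>c\<in>C. c x w})"
  (is "_ \<longleftrightarrow> ?R")
proof
  assume "soc_representable S"
  then obtain p K :: nat and d A where A: "\<And>k. k < K \<Longrightarrow> affine_map p (Suc (d k)) (A k)"
    and S: "S = {x. \<exists>w \<in> topspace (Euclidean_space p). \<forall>k<K. A k x w \<in> Lorentz_cone (d k)}"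
    unfolding soc_representable_def by blast
  have "\<forall>k\<in>{..<K}. \<exists>c. cone_constraint p c \<and>
      (\<forall>x. \<forall>w\<in>topspace (Euclidean_space p). A k x w \<in> Lorentz_cone (d k) \<longleftrightarrow> c x w)"
  proof
    fix k assume "k \<in> {..<K}"
    then have "affine_map p (Suc (d k)) (A k)"
      by (simp add: A)
    from affine_map_cone_constraint[OF this] obtain c where "cone_constraint p c"
      "\<And>x w. w \<in> topspace (Euclidean_space p) \<Longrightarrow> A k x w \<in> Lorentz_cone (d k) \<longleftrightarrow> c x w"
      by blast
    then show "\<exists>c. cone_constraint p c \<and>
      (\<forall>x. \<forall>w\<in>topspace (Euclidean_space p). A k x w \<in> Lorentz_cone (d k) \<longleftrightarrow> c x w)"
      by (intro exI[of _ c]) simp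
  qed
  from bchoice[OF this] obtain c where "\<forall>k\<in>{..<K}. cone_constraint p (c k) \<and>
      (\<forall>x. \<forall>w\<in>topspace (Euclidean_space p). A k x w \<in> Lorentz_cone (d k) \<longleftrightarrow> c k x w)" ..
  then have c: "\<And>k. k < K \<Longrightarrow> cone_constraint p (c k)"
    "\<And>k x w. k < K \<Longrightarrow> w\<in>topspace (Euclidean_space p) \<Longrightarrow> A k x w \<in> Lorentz_cone (d k) \<longleftrightarrow> c k x w"
    by simp_all
  have "S = {x. \<exists>w. \<forall>c\<in>c ` {..<K}. c x w}"
  proof (rule set_eqI, rule iffI)
    fix x assume "x \<in> {x. \<exists>w. \<forall>c\<in>c ` {..<K}. c x w}"
    then obtain w where w: "\<And>k. k < K \<Longrightarrow> c k x w"
      by auto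
    define v where "v = (\<lambda>j. if j < p then w j else 0)"
    have v: "v \<in> topspace (Euclidean_space p)"
      by (simp add: v_def topspace_Euclidean_space)
    have "c k x v" if "k < K" for k
      using cone_constraint_cong[OF c(1)[OF that], of w v x] w[OF that] by (simp add: v_def)
    then show "x \<in> S"
      using S c(2) v by blast
  qed (use S c(2) in blast)
  then show ?R
    using c(1) by (intro exI[of _ p] exI[of _ "c ` {..<K}"]) auto
next
  assume ?R
  then obtain p C where C: "finite C" "\<And>c. c \<in> C \<Longrightarrow> cone_constraint p c"
    and S: "S = {x. \<exists>w. \<forall>c\<in>C. c x w}"
    by blast
  obtain h where h: "bij_betw h {0..<card C} C"
    using ex_bij_betw_nat_finite[OF C(1)] by blast
  have hC: "h k \<in> C" if "k < card C" for k
    using h that by (auto simp: bij_betw_def)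
  have "\<forall>k\<in>{..<card C}. \<exists>dA. affine_map p (Suc (fst dA)) (snd dA) \<and>
      (\<forall>x. \<forall>w\<in>topspace (Euclidean_space p). snd dA x w \<in> Lorentz_cone (fst dA) \<longleftrightarrow> h k x w)"
  proof
    fix k assume "k \<in> {..<card C}"
    then have "cone_constraint p (h k)"
      by (simp add: C(2) hC)
    from cone_constraint_affine_map[OF this] obtain d A where "affine_map p (Suc d) A"
      "\<And>x w. w \<in> topspace (Euclidean_space p) \<Longrightarrow> A x w \<in> Lorentz_cone d \<longleftrightarrow> h k x w"
      by blast
    then show "\<exists>dA. affine_map p (Suc (fst dA)) (snd dA) \<and>
      (\<forall>x. \<forall>w\<in>topspace (Euclidean_space p). snd dA x w \<in> Lorentz_cone (fst dA) \<longleftrightarrow> h k x w)"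
      by (intro exI[of _ "(d, A)"]) simp
  qed
  from bchoice[OF this] obtain dA where "\<forall>k\<in>{..<card C}. affine_map p (Suc (fst (dA k))) (snd (dA k)) \<and>
      (\<forall>x. \<forall>w\<in>topspace (Euclidean_space p). snd (dA k) x w \<in> Lorentz_cone (fst (dA k)) \<longleftrightarrow> h k x w)" ..
  moreover define d where "d k = fst (dA k)" for k
  moreover define A where "A k = snd (dA k)" for k
  ultimately have A: "\<And>k. k < card C \<Longrightarrow> affine_map p (Suc (d k)) (A k)"
    "\<And>k x w. k < card C \<Longrightarrow> w\<in>topspace (Euclidean_space p) \<Longrightarrow> A k x w \<in> Lorentz_cone (d k) \<longleftrightarrow> h k x w"
    by simp_all
  have all: "(\<forall>c\<in>C. c x w) \<longleftrightarrow> (\<forall>k<card C. h k x w)" for x w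
  proof -
    have "C = h ` {..<card C}"
      using h by (simp add: bij_betw_def lessThan_atLeast0)
    then show ?thesis
      by (metis (no_types, lifting) imageE imageI lessThan_iff)
  qed
  have "S = {x. \<exists>w \<in> topspace (Euclidean_space p). \<forall>k<card C. A k x w \<in> Lorentz_cone (d k)}"
  proof (rule set_eqI, rule iffI)
    fix x assume "x \<in> S"
    then obtain w where w: "\<And>k. k < card C \<Longrightarrow> h k x w"
      using S all by blast
    define v where "v = (\<lambda>j. if j < p then w j else 0)"
    have v: "v \<in> topspace (Euclidean_space p)"
      by (simp add: v_def topspace_Euclidean_space)
    have "h k x v" if "k < card C" for k
      using cone_constraint_cong[OF C(2)[OF hC[OF that]], of w v x] w[OF that] by (simp add: v_def)
    then show "x \<in> {x. \<exists>w \<in> topspace (Euclidean_space p). \<forall>k<card C. A k x w \<in> Lorentz_cone (d k)}"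
      using A(2) v by blast
  qed (use S all A(2) in blast)
  then show "soc_representable S"
    unfolding soc_representable_def using A(1)
    by (intro exI[of _ p] exI[of _ "card C"] exI[of _ d] exI[of _ A] conjI allI impI)
qed

section \<open>Closure properties of representability\<close>

text \<open>The auxiliary variables of \<open>S\<close> are placed after the \<open>q\<close>
  variables of \<open>g\<close>, which merges the two existential quantifiers. Linear preimages and
  sections are the case \<open>q = 0\<close>; projections use \<open>w\<close> for the coordinates
  of the eliminated vector.\<close>

lemma soc_representable_joint_preimage:
  assumes "soc_representable S" and g: "joint_affine_vec q g"
  shows "soc_representable {x. \<exists>w. g x w \<in> S}"
proof -
  obtain p C where C: "finite C" "\<And>c. c \<in> C \<Longrightarrow> cone_constraint p c"
    and S: "S = {x. \<exists>w. \<forall>c\<in>C. c x w}"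
    using assms(1) unfolding soc_representable_iff by blast
  define E where "E = (\<lambda>c x w. c (g x w) (\<lambda>j. w (q + j))) ` C"
  have "cone_constraint (q + p) (\<lambda>x w. c (g x w) (\<lambda>j. w (q + j)))" if "c \<in> C" for c
    by (rule cone_constraint_compose[OF C(2)[OF that]])
      (auto intro: joint_affine_coord joint_affine_vec_mono[OF g])
  then have "cone_constraint (q + p) c" if "c \<in> E" for c
    using that unfolding E_def by blast
  moreover have "{x. \<exists>w. g x w \<in> S} = {x. \<exists>w. \<forall>c\<in>E. c x w}"
  proof (rule set_eqI, rule iffI)
    fix x assume "x \<in> {x. \<exists>w. g x w \<in> S}"
    then obtain w v where "\<forall>c\<in>C. c (g x w) v"
      using S by blast
    moreover define u where "u = (\<lambda>j. if j < q then w j else v (j - q))"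
    moreover have "g x u = g x w"
      by (rule joint_affine_vec_cong[OF g]) (simp add: u_def)
    ultimately have "\<forall>c\<in>E. c x u"
      by (simp add: E_def)
    then show "x \<in> {x. \<exists>w. \<forall>c\<in>E. c x w}"
      by blast
  qed (auto simp: E_def S)
  ultimately show ?thesis
    unfolding soc_representable_iff using C(1)
    by (intro exI[of _ "q + p"] exI[of _ E] conjI ballI) (simp_all add: E_def)
qed

text \<open>The auxiliary variables of \<open>T\<close> are shifted by \<open>p\<close>, so that the
  witnesses for \<open>S\<close> and \<open>T\<close> occupy disjoint positions and can be chosen
  independently.\<close>

lemma soc_representable_Int:
  assumes "soc_representable S" and "soc_representable T"
  shows "soc_representable (S \<inter> T)"
proof -
  obtain p C where C: "finite C" "\<And>c. c \<in> C \<Longrightarrow> cone_constraint p c"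
    and S: "S = {x. \<exists>w. \<forall>c\<in>C. c x w}"
    using assms(1) unfolding soc_representable_iff by blast
  obtain q D where D: "finite D" "\<And>c. c \<in> D \<Longrightarrow> cone_constraint q c"
    and T: "T = {x. \<exists>w. \<forall>c\<in>D. c x w}"
    using assms(2) unfolding soc_representable_iff by blast
  define E where "E = C \<union> (\<lambda>c x w. c x (\<lambda>j. w (p + j))) ` D"
  have "cone_constraint (p + q) (\<lambda>x w. c x (\<lambda>j. w (p + j)))" if "c \<in> D" for c
    by (rule cone_constraint_compose[OF D(2)[OF that] joint_affine_vec_point])
      (simp add: joint_affine_coord)
  moreover have "cone_constraint (p + q) c" if "c \<in> C" for c
    by (rule cone_constraint_mono[OF C(2)[OF that]]) simp
  ultimately have "cone_constraint (p + q) c" if "c \<in> E" for c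
    using that unfolding E_def by blast
  moreover have "S \<inter> T = {x. \<exists>w. \<forall>c\<in>E. c x w}"
  proof (rule set_eqI, rule iffI)
    fix x assume "x \<in> S \<inter> T"
    then obtain w v where w: "\<forall>c\<in>C. c x w" and v: "\<forall>c\<in>D. c x v"
      using S T by blast
    define u where "u = (\<lambda>j. if j < p then w j else v (j - p))"
    have "c x u" if "c \<in> C" for c
    proof -
      have "c x u = c x w"
        by (rule cone_constraint_cong[OF C(2)[OF that]]) (simp add: u_def)
      then show ?thesis
        using bspec[OF w that] by simp
    qed
    then have "\<forall>c\<in>E. c x u"
      using v by (auto simp: E_def u_def)
    then show "x \<in> {x. \<exists>w. \<forall>c\<in>E. c x w}"
      by blast
  next
    fix x assume "x \<in> {x. \<exists>w. \<forall>c\<in>E. c x w}"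
    then obtain w where "(\<forall>c\<in>C. c x w) \<and> (\<forall>c\<in>D. c x (\<lambda>j. w (p + j)))"
      unfolding E_def ball_Un by (simp only: ball_simps mem_Collect_eq) (elim exE that)
    then show "x \<in> S \<inter> T"
      unfolding S T by (intro IntI CollectI exI) (erule conjunct1, erule conjunct2)
  qed
  moreover have "finite E"
    using C(1) D(1) by (simp add: E_def)
  ultimately show ?thesis
    unfolding soc_representable_iff
    by (intro exI[of _ "p + q"] exI[of _ E] conjI ballI)
qed

lemma soc_representable_halfspace: "soc_representable {x. a \<bullet> x \<le> b}"
proof -
  \<comment> \<open>For \<open>d = 0\<close> the norm is an empty sum, and the cone constraint reads
    \<open>0 \<le> b - a \<bullet> x\<close>.\<close>
  define c where "c = (\<lambda>(x::'a) (w::nat \<Rightarrow> real). L2_set (\<lambda>i. b - a \<bullet> x) {..<0::nat} \<le> b - a \<bullet> x)"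
  have "cone_constraint 0 c"
    unfolding cone_constraint_def c_def
    by (rule exI[of _ 0], rule exI[of _ "\<lambda>_ x w. b - a \<bullet> x"])
      (simp add: joint_affine_diff joint_affine_const joint_affine_inner)
  then show ?thesis
    unfolding soc_representable_iff
    by (intro exI[of _ 0] exI[of _ "{c}"]) (simp add: c_def)
qed

lemma soc_representable_UNIV: "soc_representable UNIV"
  using soc_representable_halfspace[of 0 0] by simp

lemma soc_representable_INT:
  assumes "finite I" and "\<And>i. i \<in> I \<Longrightarrow> soc_representable (S i)"
  shows "soc_representable (\<Inter>i\<in>I. S i)"
  using assms
  by (induction I rule: finite_induct) (simp_all add: soc_representable_UNIV soc_representable_Int)

lemma soc_representable_zero: "soc_representable {0}"
proof -
  have "{0::'a} = (\<Inter>b\<in>Basis. {x. b \<bullet> x \<le> 0} \<inter> {x. (-b) \<bullet> x \<le> 0})"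
    by (auto simp: euclidean_all_zero_iff intro!: euclidean_eqI[of _ 0] order_antisym)
      (simp_all add: inner_commute)
  then show ?thesis
    by (simp only:) (intro soc_representable_INT soc_representable_Int soc_representable_halfspace finite_Basis)
qed

lemma soc_representable_linear_preimage:
  assumes "soc_representable S" and "linear f"
  shows "soc_representable {x. f x \<in> S}"
proof -
  have "joint_affine_vec 0 (\<lambda>x w. f x)"
    unfolding joint_affine_vec_def
    by (simp add: inner_commute[of _ "f _"] adjoint_works[OF assms(2), symmetric] inner_commute[of _ "adjoint f _"]
      joint_affine_inner)
  from soc_representable_joint_preimage[OF assms(1) this] show ?thesis
    by simp
qed

lemma soc_representable_proj:
  fixes S :: "('a::euclidean_space \<times> 'b::euclidean_space) set"
  assumes "soc_representable S"
  shows "soc_representable {x. \<exists>y. (x, y) \<in> S}"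
proof -
  define n where "n = DIM('b)"
  obtain e where e: "bij_betw e {..<n} (Basis :: 'b set)"
    using ex_bij_betw_nat_finite[OF finite_Basis] unfolding n_def lessThan_atLeast0 by blast
  \<comment> \<open>The auxiliary variables are the coordinates of \<open>y\<close> in the
    enumerated basis.\<close>
  define g where "g = (\<lambda>(x::'a) (w::nat \<Rightarrow> real). (x, \<Sum>j<n. w j *\<^sub>R e j))"
  have "joint_affine_vec n g"
    unfolding joint_affine_vec_def g_def
  proof
    fix a :: "'a \<times> 'b"
    have "a \<bullet> (x, \<Sum>j<n. w j *\<^sub>R e j) = fst a \<bullet> x + (\<Sum>j<n. (snd a \<bullet> e j) * w j)" for x w
      by (simp add: inner_prod_def inner_sum_right mult.commute)
    then show "joint_affine n (\<lambda>x w. a \<bullet> (x, \<Sum>j<n. w j *\<^sub>R e j))"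
      by (simp only:)
        (intro joint_affine_add joint_affine_inner joint_affine_sum joint_affine_cmult joint_affine_coord, simp)
  qed
  from soc_representable_joint_preimage[OF assms(1) this]
  have "soc_representable {x. \<exists>w. g x w \<in> S}" .
  moreover have "\<exists>w. y = (\<Sum>j<n. w j *\<^sub>R e j)" for y :: 'b
  proof
    have "y = (\<Sum>b\<in>Basis. (y \<bullet> b) *\<^sub>R b)"
      by (simp add: euclidean_representation)
    also have "\<dots> = (\<Sum>j<n. (y \<bullet> e j) *\<^sub>R e j)"
      using sum.reindex_bij_betw[OF e, of "\<lambda>b. (y \<bullet> b) *\<^sub>R b"] by simp
    finally show "y = (\<Sum>j<n. (y \<bullet> e j) *\<^sub>R e j)" .
  qed
  then have "(\<exists>w. g x w \<in> S) \<longleftrightarrow> (\<exists>y. (x, y) \<in> S)" for x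
    unfolding g_def by auto metis
  then have "{x. \<exists>w. g x w \<in> S} = {x. \<exists>y. (x, y) \<in> S}"
    by (simp only:)
  ultimately show ?thesis
    by simp
qed

lemma soc_representable_linear_image:
  fixes f :: "'a::euclidean_space \<Rightarrow> 'b::euclidean_space"
  assumes "soc_representable S" and "linear f"
  shows "soc_representable (f ` S)"
proof -
  \<comment> \<open>The image is the projection of the part of the graph of \<open>f\<close> that
    lies over \<open>S\<close>.\<close>
  have "soc_representable ({z. fst z - f (snd z) \<in> {0}} \<inter> {z. snd z \<in> S})"
    by (intro soc_representable_Int soc_representable_linear_preimage soc_representable_zero assms
      linear_compose_sub linear_compose[OF linear_snd assms(2), unfolded o_def]
        linear_fst linear_snd)
  from soc_representable_proj[OF this]
  have "soc_representable {x. \<exists>y. x = f y \<and> y \<in> S}"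
    by simp
  also have "{x. \<exists>y. x = f y \<and> y \<in> S} = f ` S"
    by auto
  finally show ?thesis .
qed

lemma soc_representable_Times:
  assumes "soc_representable S" and "soc_representable T"
  shows "soc_representable (S \<times> T)"
proof -
  have "S \<times> T = {z. fst z \<in> S} \<inter> {z. snd z \<in> T}"
    by auto
  then show ?thesis
    by (simp only:) (intro soc_representable_Int soc_representable_linear_preimage assms linear_fst linear_snd)
qed

lemma soc_representable_section:
  assumes "soc_representable S"
  shows "soc_representable {x. (a, x) \<in> S}"
proof -
  have "joint_affine_vec 0 (\<lambda>x w. (a, x))"
    unfolding joint_affine_vec_def
    by (simp add: inner_prod_def joint_affine_add joint_affine_const joint_affine_inner)
  from soc_representable_joint_preimage[OF assms(1) this] show ?thesis
    by simp
qed

text \<open>Since \<open>(s + t)^2 - (s - t)^2 = 4 * s * t\<close>, the condition says that the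
  vector \<open>(2 * a, s - t)\<close> has norm at most \<open>s + t\<close>. These three entries
  are the rows of \<open>F\<close>.\<close>

lemma soc_representable_rotated_cone:
  "soc_representable {z :: real \<times> real \<times> real.
     (fst z)\<^sup>2 \<le> fst (snd z) * snd (snd z) \<and> 0 \<le> fst (snd z) \<and> 0 \<le> snd (snd z)}"
proof -
  define F where "F = (\<lambda>(i::nat) (z::real \<times> real \<times> real) (w::nat \<Rightarrow> real).
     (if i = 0 then (2, 0, 0) else if i = 1 then (0, 1, -1) else (0, 1, 1)) \<bullet> z)"
  have F: "joint_affine 0 (F i)" for i
    unfolding F_def by (rule joint_affine_inner)
  have eq: "L2_set (\<lambda>i. F i z w) {..<2} \<le> F 2 z w \<longleftrightarrow>
      (fst z)\<^sup>2 \<le> fst (snd z) * snd (snd z) \<and> 0 \<le> fst (snd z) \<and> 0 \<le> snd (snd z)" for z w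
  proof -
    obtain a s t where z: "z = (a, s, t)"
      by (cases z) auto
    have "sqrt ((2 * a)\<^sup>2 + (s - t)\<^sup>2) \<le> s + t \<longleftrightarrow> a\<^sup>2 \<le> s * t \<and> 0 \<le> s \<and> 0 \<le> t"
    proof
      assume le: "sqrt ((2 * a)\<^sup>2 + (s - t)\<^sup>2) \<le> s + t"
      then have st: "0 \<le> s + t"
        by (meson order_trans real_sqrt_ge_zero sum_power2_ge_zero)
      have "(2 * a)\<^sup>2 + (s - t)\<^sup>2 \<le> (s + t)\<^sup>2"
        using le by (rule sqrt_le_D)
      then have ast: "a\<^sup>2 \<le> s * t"
        by (simp add: power2_eq_square algebra_simps)
      \<comment> \<open>A nonnegative product together with a nonnegative sum forces both numbers to
        be nonnegative.\<close>
      then have "0 \<le> s * t"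
        by (meson order_trans zero_le_power2)
      then show "a\<^sup>2 \<le> s * t \<and> 0 \<le> s \<and> 0 \<le> t"
        using ast st by (auto simp: zero_le_mult_iff)
    next
      assume "a\<^sup>2 \<le> s * t \<and> 0 \<le> s \<and> 0 \<le> t"
      then show "sqrt ((2 * a)\<^sup>2 + (s - t)\<^sup>2) \<le> s + t"
        by (intro real_le_lsqrt) (auto simp: power2_eq_square algebra_simps)
    qed
    then show ?thesis
      by (simp add: z F_def L2_set_def numeral_2_eq_2)
  qed
  have "cone_constraint 0 (\<lambda>z w. L2_set (\<lambda>i. F i z w) {..<2} \<le> F 2 z w)"
    unfolding cone_constraint_def using F by blast
  then show ?thesis
    unfolding soc_representable_iff
    by (intro exI[of _ 0] exI[of _ "{\<lambda>z w. L2_set (\<lambda>i. F i z w) {..<2} \<le> F 2 z w}"])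
      (simp add: eq)
qed

section \<open>Convex hulls of hyperbola arcs\<close>

text \<open>Homogenization turns the convex hull of a union into a sum of cones.\<close>

lemma convex_hull_slice:
  "convex hull S = {x. (1::real, x) \<in> convex_cone hull ({1} \<times> S)}"
proof (rule set_eqI, rule iffI)
  fix x assume "x \<in> convex hull S"
  then have "(1, x) \<in> convex hull ({1::real} \<times> S)"
    by (simp add: convex_hull_Times)
  then show "x \<in> {x. (1::real, x) \<in> convex_cone hull ({1} \<times> S)}"
    using convex_hull_subset_convex_cone_hull by blast
next
  fix x assume "x \<in> {x. (1::real, x) \<in> convex_cone hull ({1} \<times> S)}"
  \<comment> \<open>The cone consists of 0 and the multiples c (1, y) with y in the hull; a first
    coordinate equal to 1 excludes 0 and forces c = 1.\<close>
  then have "(1::real, x) \<in> insert 0 (\<Union>y \<in> convex hull ({1} \<times> S). \<Union>c\<in>{0..}. {c *\<^sub>R y})"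
    by (simp add: convex_cone_hull_convex_hull[of "{1::real} \<times> S"])
  then show "x \<in> convex hull S"
    by (auto simp: convex_hull_Times zero_prod_def)
qed

text \<open>The cone generated by a union is the sum of the generated cones, and a sum is the image
  of a product under the linear map of addition.\<close>

lemma soc_representable_convex_cone_hull_UN:
  assumes "finite I" and "\<And>i. i \<in> I \<Longrightarrow> soc_representable (convex_cone hull (S i))"
  shows "soc_representable (convex_cone hull (\<Union>i\<in>I. S i))"
  using assms
proof (induction I rule: finite_induct)
  case empty
  then show ?case
    by (simp add: soc_representable_zero)
next
  case (insert i I)
  let ?A = "convex_cone hull (S i)" and ?B = "convex_cone hull (\<Union>i\<in>I. S i)"
  have "linear (\<lambda>z::'b \<times> 'b. fst z + snd z)"
    by (intro linear_compose_add linear_fst linear_snd)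
  then have "soc_representable ((\<lambda>z. fst z + snd z) ` (?A \<times> ?B))"
    using insert by (intro soc_representable_linear_image soc_representable_Times) auto
  moreover have "(\<lambda>z. fst z + snd z) ` (?A \<times> ?B) = convex_cone hull (S i \<union> (\<Union>i\<in>I. S i))"
    unfolding convex_cone_hull_Un by force
  ultimately show ?case
    by simp
qed

text \<open>At height 1 the right-hand side is the region between the hyperbola and its chord over
  \<open>{p..q}\<close>, which is the convex hull of the arc. The last inequality of
  \<open>?H\<close> is the homogenized chord through the points (p, 1/p) and (q, 1/q).\<close>

lemma convex_cone_hull_hyperbola_arc:
  fixes p q :: real
  assumes "0 < p" and "p \<le> q"
  shows "convex_cone hull ((\<lambda>s. (1, s, 1 / s)) ` {p..q}) =
    {z. (fst z)\<^sup>2 \<le> fst (snd z) * snd (snd z) \<and> 0 \<le> fst (snd z) \<and> 0 \<le> snd (snd z)} \<inter>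
    {z. 0 \<le> fst z \<and> p * fst z \<le> fst (snd z) \<and> fst (snd z) \<le> q * fst z \<and>
        fst (snd z) + p * q * snd (snd z) \<le> (p + q) * fst z}"
    (is "convex_cone hull ?A = ?C \<inter> ?H")
proof
  show "convex_cone hull ?A \<subseteq> ?C \<inter> ?H"
  proof (rule hull_minimal)
    have "s + p * q * (1 / s) \<le> p + q" if "p \<le> s" "s \<le> q" for s
    proof -
      \<comment> \<open>Divided by \<open>s\<close>, this is the statement that the arc lies below
        its chord.\<close>
      have "0 \<le> (s - p) * (q - s)"
        using that by simp
      then show ?thesis
        using that assms by (simp add: field_simps)
    qed
    then show "?A \<subseteq> ?C \<inter> ?H"
      using assms by auto
    \<comment> \<open>This closes the rotated cone under addition. It is Cauchy-Schwarz for the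
      vectors (sqrt s, sqrt s') and (sqrt t, sqrt t').\<close>
    have add: "(a + a')\<^sup>2 \<le> (s + s') * (t + t')"
      if "a\<^sup>2 \<le> s * t" "a'\<^sup>2 \<le> s' * t'" and nn: "0 \<le> s" "0 \<le> t" "0 \<le> s'" "0 \<le> t'"
      for a a' s s' t t' :: real
    proof -
      have "\<bar>a\<bar> \<le> sqrt (s * t)" "\<bar>a'\<bar> \<le> sqrt (s' * t')"
        using that by (simp_all add: real_le_rsqrt)
      then have "\<bar>a + a'\<bar> \<le> sqrt s * sqrt t + sqrt s' * sqrt t'"
        by (simp add: real_sqrt_mult)
      moreover have "(sqrt s * sqrt t + sqrt s' * sqrt t')\<^sup>2 \<le> (s + s') * (t + t')"
      proof -
        have "0 \<le> (sqrt s * sqrt t' - sqrt s' * sqrt t)\<^sup>2"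
          by simp
        then show ?thesis
          using nn by (simp add: power2_diff power2_sum power_mult_distrib algebra_simps)
      qed
      ultimately show ?thesis
        using power_mono[of "\<bar>a + a'\<bar>" "sqrt s * sqrt t + sqrt s' * sqrt t'" 2] by simp
    qed
    show "convex_cone (?C \<inter> ?H)"
      unfolding convex_cone_iff
    proof (intro conjI ballI allI impI)
      fix x y assume "x \<in> ?C \<inter> ?H" "y \<in> ?C \<inter> ?H"
      then show "x + y \<in> ?C \<inter> ?H"
        using add[of "fst x" "fst (snd x)" "snd (snd x)" "fst y" "fst (snd y)" "snd (snd y)"]
        by (auto simp: distrib_left distrib_right)
    next
      fix x and c :: real assume x: "x \<in> ?C \<inter> ?H" and c: "0 \<le> c"
      have "(c * fst x)\<^sup>2 \<le> (c * fst (snd x)) * (c * snd (snd x))"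
        using x mult_left_mono[of "(fst x)\<^sup>2" "fst (snd x) * snd (snd x)" "c\<^sup>2"]
        by (simp add: power2_eq_square mult_ac)
      moreover have "c * (p * fst x) \<le> c * fst (snd x)" "c * fst (snd x) \<le> c * (q * fst x)"
        "c * (fst (snd x) + p * q * snd (snd x)) \<le> c * ((p + q) * fst x)"
        using x c by (auto intro!: mult_left_mono)
      ultimately show "c *\<^sub>R x \<in> ?C \<inter> ?H"
        using x c by (simp add: algebra_simps)
    qed auto
  qed
next
  show "?C \<inter> ?H \<subseteq> convex_cone hull ?A"
  proof
    fix z assume z: "z \<in> ?C \<inter> ?H"
    obtain a s t where zst: "z = (a, s, t)"
      by (cases z) auto
    have h: "a\<^sup>2 \<le> s * t" "0 \<le> s" "0 \<le> t" "0 \<le> a" "p * a \<le> s" "s \<le> q * a" "s + p * q * t \<le> (p + q) * a"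
      using z by (simp_all add: zst)
    have arc: "(1, r, 1 / r) \<in> convex_cone hull ?A" if "p \<le> r" "r \<le> q" for r
      using that by (auto intro!: hull_inc)
    show "z \<in> convex_cone hull ?A"
    proof (cases "a = 0")
      case True
      \<comment> \<open>At height 0 the bounds by \<open>p * a\<close> and \<open>q * a\<close> give
        \<open>s = 0\<close>, and then the chord inequality leaves
        \<open>p * q * t \<le> 0\<close>.\<close>
      then have "s = 0" "t = 0"
        using h assms mult_pos_pos[of p q] by (auto simp: mult_le_0_iff)
      then have "z = 0"
        by (simp add: zst True zero_prod_def)
      then show ?thesis
        by (simp add: convex_cone_hull_contains_0)
    next
      case False
      then have a: "0 < a"
        using h by simp
      \<comment> \<open>Rescaling to height 1 gives the point (r, v), which is shown to lie on a
        vertical segment from the arc up to the chord.\<close>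
      define r where "r = s / a"
      define v where "v = t / a"
      have s: "s = a * r" and t: "t = a * v"
        using a by (simp_all add: r_def v_def)
      have r: "p \<le> r" "r \<le> q" "0 < r"
        using h a assms by (simp_all add: r_def field_simps) (metis a assms(1) less_le_trans mult_pos_pos)
      have "1 \<le> r * v"
        using h(1) a unfolding s t by (simp add: power2_eq_square field_simps)
      then have v1: "1 / r \<le> v"
        using r by (simp add: field_simps)
      have "a * (r + p * q * v) \<le> a * (p + q)"
        using h(7) unfolding s t by (simp add: algebra_simps)
      then have "r + p * q * v \<le> p + q"
        using a by simp
      then have v2: "v \<le> (p + q - r) / (p * q)"
        using assms by (simp add: field_simps)
      \<comment> \<open>\<open>g\<close> is the height of the chord above \<open>r\<close>.\<close>
      define g where "g = (p + q - r) / (p * q)"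
      have chord: "(1, r, g) \<in> convex_cone hull ?A"
      proof (cases "p = q")
        case True
        then have "r = p" "g = 1 / p"
          using r assms by (auto simp: g_def field_simps)
        then show ?thesis
          using arc[of p] assms by simp
      next
        case False
        \<comment> \<open>\<open>m\<close> is the position of \<open>r\<close> in the interval; the
          chord point is the same convex combination of the two ends of the arc.\<close>
        define m where "m = (r - p) / (q - p)"
        have m: "0 \<le> m" "m \<le> 1"
          using False assms r by (auto simp: m_def field_simps)
        have rm: "r = p + m * (q - p)"
          using False by (simp add: m_def)
        have "g = (1 - m) * (1 / p) + m * (1 / q)"
          unfolding g_def rm using assms by (simp add: field_simps)
        then have eq: "(1, r, g) = (1 - m) *\<^sub>R (1, p, 1 / p) + m *\<^sub>R (1, q, 1 / q)"
          by (simp add: rm algebra_simps)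
        show ?thesis
          unfolding eq using m assms
          by (intro convex_cone_hull_add convex_cone_hull_mul arc) auto
      qed
      have "(1, r, v) \<in> closed_segment (1, r, 1 / r) (1, r, g)"
      proof -
        have "v \<in> closed_segment (1 / r) g"
          using v1 v2 by (simp add: g_def closed_segment_eq_real_ivl)
        then obtain u where u: "0 \<le> u" "u \<le> 1" "v = (1 - u) * (1 / r) + u * g"
          by (auto simp: closed_segment_def)
        then show ?thesis
          unfolding in_segment by (intro exI[of _ u]) (simp add: algebra_simps)
      qed
      moreover have "closed_segment (1, r, 1 / r) (1, r, g) \<subseteq> convex_cone hull ?A"
        using closed_segment_subset[OF arc[OF r(1,2)] chord convex_convex_cone_hull] .
      ultimately have "a *\<^sub>R (1, r, v) \<in> convex_cone hull ?A"
        using a by (intro convex_cone_hull_mul) auto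
      then show ?thesis
        by (simp add: zst s t)
    qed
  qed
qed

lemma soc_representable_hyperbola_arc_cone:
  fixes p q :: real
  assumes "0 < p"
  shows "soc_representable (convex_cone hull ((\<lambda>s. (1::real, s, 1 / s)) ` {p..q}))"
proof (cases "p \<le> q")
  case False
  then show ?thesis
    by (simp add: soc_representable_zero)
next
  case True
  have "{z::real \<times> real \<times> real. 0 \<le> fst z \<and> p * fst z \<le> fst (snd z) \<and> fst (snd z) \<le> q * fst z \<and>
        fst (snd z) + p * q * snd (snd z) \<le> (p + q) * fst z} =
     {z. (-1, 0, 0) \<bullet> z \<le> 0} \<inter> {z. (p, -1, 0) \<bullet> z \<le> 0} \<inter> {z. (-q, 1, 0) \<bullet> z \<le> 0} \<inter>
     {z. (-(p + q), 1, p * q) \<bullet> z \<le> 0}"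
    by (auto simp: inner_prod_def algebra_simps)
  then show ?thesis
    unfolding convex_cone_hull_hyperbola_arc[OF assms True]
    by (simp only:) (intro soc_representable_Int soc_representable_rotated_cone soc_representable_halfspace)
qed

text \<open>Degenerate arcs are included: the interval may be empty, and with \<open>R = 0\<close>
  the arc is a segment or a point. Only the left end has to be positive.\<close>

definition hyperbola_arc :: "'a::euclidean_space set \<Rightarrow> bool" where
  "hyperbola_arc S \<longleftrightarrow> (\<exists>P Q R p q. 0 < p \<and> S = (\<lambda>s. P + s *\<^sub>R Q + (1 / s) *\<^sub>R R) ` {p..q})"

lemma soc_representable_convex_hull_hyperbola_arcs:
  assumes "finite I" and "\<And>i. i \<in> I \<Longrightarrow> hyperbola_arc (S i)"
  shows "soc_representable (convex hull (\<Union>i\<in>I. S i))"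
proof -
  have "soc_representable (convex_cone hull ({1::real} \<times> S i))" if "i \<in> I" for i
  proof -
    obtain P Q R p q where p: "0 < p" and S: "S i = (\<lambda>s. P + s *\<^sub>R Q + (1 / s) *\<^sub>R R) ` {p..q}"
      using assms(2)[OF \<open>i \<in> I\<close>] unfolding hyperbola_arc_def by blast
    \<comment> \<open>The homogenizing coordinate carries the constant term \<open>P\<close>, so the
      arc at height 1 is a linear image of the model arc of points (1, s, 1/s).\<close>
    define G where "G z = (fst z, fst z *\<^sub>R P + fst (snd z) *\<^sub>R Q + snd (snd z) *\<^sub>R R)"
      for z :: "real \<times> real \<times> real"
    have G: "linear G"
      by (rule linearI) (simp_all add: G_def algebra_simps)
    have "{1} \<times> S i = G ` (\<lambda>s. (1, s, 1 / s)) ` {p..q}"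
      by (auto simp: S G_def image_image)
    then show ?thesis
      using soc_representable_linear_image[OF soc_representable_hyperbola_arc_cone[OF p, of q] G]
      by (simp add: convex_cone_hull_linear_image[OF G])
  qed
  then have "soc_representable (convex_cone hull (\<Union>i\<in>I. {1::real} \<times> S i))"
    by (rule soc_representable_convex_cone_hull_UN[OF assms(1)])
  moreover have "(\<Union>i\<in>I. {1::real} \<times> S i) = {1} \<times> (\<Union>i\<in>I. S i)"
    by auto
  ultimately show ?thesis
    unfolding convex_hull_slice by (intro soc_representable_section) simp
qed

section \<open>Rank-one transport matrices\<close>

text \<open>Replacing the rank by two-by-two minors gives polynomial equations that can be summed
  over indices and define a closed set. Forwards, all rows are multiples of one vector; backwards, a
  row with a nonzero entry spans all rows.\<close>

lemma rank_le_1_iff: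
  fixes X :: "real^'n^'m"
  shows "rank X \<le> 1 \<longleftrightarrow> (\<forall>i j k l. X $ i $ j * X $ k $ l = X $ i $ l * X $ k $ j)"
proof
  assume "rank X \<le> 1"
  then have dim: "dim (rows X) \<le> 1"
    by (simp add: row_rank_def)
  obtain B where B: "B \<subseteq> rows X" "independent B" "rows X \<subseteq> span B" "card B = dim (rows X)"
    using basis_exists by blast
  have "finite B"
    using B(2) by (rule independent_imp_finite)
  obtain v where "B \<subseteq> {v}"
  proof (cases "B = {}")
    case False
    then have "card B \<noteq> 0"
      using \<open>finite B\<close> by simp
    then have "card B = 1"
      using B(4) dim by linarith
    then show ?thesis
      using that card_1_singletonE by blast
  qed (use that in blast)
  then have "rows X \<subseteq> span {v}"
    using B(3) span_mono by blast
  then have "\<exists>c. X $ i = c *\<^sub>R v" for i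
    by (auto simp: rows_def row_def span_singleton)
  then obtain c where "\<And>i. X $ i = c i *\<^sub>R v"
    by metis
  then show "\<forall>i j k l. X $ i $ j * X $ k $ l = X $ i $ l * X $ k $ j"
    by simp
next
  assume minors: "\<forall>i j k l. X $ i $ j * X $ k $ l = X $ i $ l * X $ k $ j"
  have "\<exists>v. rows X \<subseteq> span {v}"
  proof (cases "\<exists>k l. X $ k $ l \<noteq> 0")
    case True
    then obtain k l where kl: "X $ k $ l \<noteq> 0"
      by blast
    have "X $ i = (X $ i $ l / X $ k $ l) *\<^sub>R X $ k" for i
      using minors kl by (simp add: vec_eq_iff divide_simps)
    then have "X $ i \<in> span {X $ k}" for i
      unfolding span_singleton by blast
    then show ?thesis
      by (intro exI[of _ "X $ k"]) (auto simp: rows_def row_def)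
  next
    case False
    then have "X = 0"
      by (simp add: vec_eq_iff)
    then have "rows X \<subseteq> {0}"
      by (auto simp: rows_def row_def vec_eq_iff)
    then show ?thesis
      using span_superset by blast
  qed
  then obtain v where "rows X \<subseteq> span {v}" ..
  then have "dim (rows X) \<le> card {v}"
    by (intro dim_le_card) simp_all
  then show "rank X \<le> 1"
    by (simp add: row_rank_def)
qed

section \<open>Row and column sums determine a rank-one matrix\<close>

definition row_sum :: "real^'n^'m \<Rightarrow> 'm \<Rightarrow> real" where
  "row_sum X i = (\<Sum>j\<in>UNIV. X $ i $ j)"

definition col_sum :: "real^'n^'m \<Rightarrow> 'n \<Rightarrow> real" where
  "col_sum X j = (\<Sum>i\<in>UNIV. X $ i $ j)"

definition total_sum :: "real^'n^'m \<Rightarrow> real" where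
  "total_sum X = (\<Sum>i\<in>UNIV. \<Sum>j\<in>UNIV. X $ i $ j)"

lemma mem_rank_one_transport_iff:
  "X \<in> rank_one_transport l u l' u' L U \<longleftrightarrow>
    (\<forall>i j. 0 \<le> X $ i $ j) \<and> (\<forall>i j k h. X $ i $ j * X $ k $ h = X $ i $ h * X $ k $ j) \<and>
    (\<forall>i. l $ i \<le> row_sum X i \<and> row_sum X i \<le> u $ i) \<and>
    (\<forall>j. l' $ j \<le> col_sum X j \<and> col_sum X j \<le> u' $ j) \<and>
    L \<le> total_sum X \<and> total_sum X \<le> U"
  unfolding rank_one_transport_def row_sum_def col_sum_def total_sum_def
  by (simp only: mem_Collect_eq rank_le_1_iff)

lemma sum_row_sum: "(\<Sum>i\<in>UNIV. row_sum X i) = total_sum X"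
  by (simp add: row_sum_def total_sum_def)

lemma sum_col_sum: "(\<Sum>j\<in>UNIV. col_sum X j) = total_sum X"
  unfolding col_sum_def total_sum_def by (rule sum.swap)

text \<open>This symmetry transfers the perturbation argument from columns to rows.\<close>

lemma transpose_mem_rank_one_transport:
  assumes "X \<in> rank_one_transport l u l' u' L U"
  shows "transpose X \<in> rank_one_transport l' u' l u L U"
proof -
  have "row_sum (transpose X) = col_sum X" "col_sum (transpose X) = row_sum X"
    by (simp_all add: row_sum_def col_sum_def transpose_def fun_eq_iff)
  moreover from this have "total_sum (transpose X) = total_sum X"
    by (metis sum_col_sum sum_row_sum)
  ultimately show ?thesis
    using assms unfolding mem_rank_one_transport_iff
    by (auto simp: transpose_def mult.commute)
qed

text \<open>For s = 0 this is the zero matrix, because x / 0 = 0.\<close>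

definition outer :: "real \<Rightarrow> ('m \<Rightarrow> real) \<Rightarrow> ('n \<Rightarrow> real) \<Rightarrow> real^'n^'m" where
  "outer s a b = (\<chi> i j. a i * b j / s)"

text \<open>Summing the minor equations over \<open>k\<close> and \<open>h\<close> gives entry times
  total = row sum times column sum. If the total is 0, nonnegativity makes all entries 0, in
  agreement with division by 0.\<close>

lemma rank_one_transport_eq_outer:
  assumes "X \<in> rank_one_transport l u l' u' L U"
  shows "X = outer (total_sum X) (row_sum X) (col_sum X)"
proof -
  have nn: "0 \<le> X $ i $ j" and minor: "X $ i $ j * X $ k $ h = X $ i $ h * X $ k $ j" for i j k h
    using assms by (auto simp: mem_rank_one_transport_iff)
  have "X $ i $ j * total_sum X = row_sum X i * col_sum X j" for i j
  proof -
    have "X $ i $ j * total_sum X = (\<Sum>k\<in>UNIV. \<Sum>h\<in>UNIV. X $ i $ j * X $ k $ h)"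
      by (simp add: total_sum_def sum_distrib_left)
    also have "\<dots> = (\<Sum>k\<in>UNIV. \<Sum>h\<in>UNIV. X $ i $ h * X $ k $ j)"
      by (simp only: minor[of i j])
    also have "\<dots> = (\<Sum>h\<in>UNIV. \<Sum>k\<in>UNIV. X $ i $ h * X $ k $ j)"
      by (rule sum.swap)
    also have "\<dots> = row_sum X i * col_sum X j"
      by (simp add: row_sum_def col_sum_def sum_product)
    finally show ?thesis .
  qed
  moreover have "X $ i $ j = 0" if "total_sum X = 0" for i j
    using that nn unfolding total_sum_def
    by (simp add: sum_nonneg_eq_0_iff sum_nonneg)
  ultimately have "X $ i $ j = row_sum X i * col_sum X j / total_sum X" for i j
    by (cases "total_sum X = 0") (simp_all add: eq_divide_eq)
  then show ?thesis
    by (simp add: outer_def vec_eq_iff)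
qed

text \<open>Because \<open>a\<close> and \<open>b\<close> both sum to \<open>s\<close>, they are the
  row and column sums of the outer product. For \<open>s = 0\<close> nonnegativity forces
  \<open>a\<close> and \<open>b\<close> to vanish, so this remains true there.\<close>

lemma outer_mem_rank_one_transport:
  assumes a: "\<And>i. 0 \<le> a i \<and> l $ i \<le> a i \<and> a i \<le> u $ i"
    and b: "\<And>j. 0 \<le> b j \<and> l' $ j \<le> b j \<and> b j \<le> u' $ j"
    and s: "(\<Sum>i\<in>UNIV. a i) = s" "(\<Sum>j\<in>UNIV. b j) = s" "L \<le> s" "s \<le> U"
  shows "outer s a b \<in> rank_one_transport l u l' u' L U"
proof -
  have "0 \<le> s"
    using s(1) a by (auto intro: sum_nonneg)
  have zero: "a i = 0" "b j = 0" if "s = 0" for i j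
    using that s(1,2) a b by (auto simp: sum_nonneg_eq_0_iff)
  have row: "row_sum (outer s a b) i = a i" for i
  proof -
    have "row_sum (outer s a b) i = a i * s / s"
      by (simp add: row_sum_def outer_def s(2)[symmetric] sum_distrib_left sum_divide_distrib)
    then show ?thesis
      using zero by (cases "s = 0") auto
  qed
  have "col_sum (outer s a b) j = s * b j / s" for j
    by (simp add: col_sum_def outer_def s(1)[symmetric] sum_distrib_right sum_divide_distrib)
  then have col: "col_sum (outer s a b) j = b j" for j
    using zero by (cases "s = 0") auto
  have "total_sum (outer s a b) = s"
    using sum_row_sum[of "outer s a b"] s(1) by (simp add: row)
  then show ?thesis
    unfolding mem_rank_one_transport_iff using a b s(3,4) \<open>0 \<le> s\<close>
    by (simp add: row col) (simp add: outer_def)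
qed

text \<open>Nonnegativity and the bound on the total sum bound the norm; with the rank written
  through minors, every condition is closed.\<close>

lemma compact_rank_one_transport:
  "compact (rank_one_transport l u l' u' L U)"
proof -
  let ?T = "rank_one_transport l u l' u' L U"
  have "norm X \<le> U" if "X \<in> ?T" for X
  proof -
    have nn: "0 \<le> X $ i $ j" and le: "total_sum X \<le> U" for i j
      using that by (auto simp: mem_rank_one_transport_iff)
    have "norm X \<le> (\<Sum>i\<in>UNIV. norm (X $ i))"
      unfolding norm_vec_def by (rule L2_set_le_sum) simp
    also have "\<dots> \<le> (\<Sum>i\<in>UNIV. \<Sum>j\<in>UNIV. \<bar>X $ i $ j\<bar>)"
      by (intro sum_mono norm_le_l1_cart)
    finally show ?thesis
      using le nn by (simp add: total_sum_def)
  qed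
  then have "bounded ?T"
    unfolding bounded_iff by blast
  moreover have "closed ?T"
  proof -
    have "?T = {X. (\<forall>i j. 0 \<le> X $ i $ j) \<and> (\<forall>i j k h. X $ i $ j * X $ k $ h = X $ i $ h * X $ k $ j) \<and>
      (\<forall>i. l $ i \<le> row_sum X i \<and> row_sum X i \<le> u $ i) \<and>
      (\<forall>j. l' $ j \<le> col_sum X j \<and> col_sum X j \<le> u' $ j) \<and>
      L \<le> total_sum X \<and> total_sum X \<le> U}"
      by (rule set_eqI) (simp only: mem_rank_one_transport_iff mem_Collect_eq)
    then show ?thesis
      unfolding row_sum_def col_sum_def total_sum_def
      by (simp only:) (intro closed_Collect_conj closed_Collect_all closed_Collect_le closed_Collect_eq
        continuous_intros)
  qed
  ultimately show ?thesis
    by (simp add: compact_eq_bounded_closed)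
qed

section \<open>Extreme points have at most one free row sum and one free column sum\<close>

text \<open>An amount \<open>e\<close>, the least slack of the two columns, is moved from one column
  sum to the other. Row sums and total stay fixed, and with these fixed the outer product is linear
  in the column sums, so both perturbed matrices keep rank at most one.\<close>

lemma rank_one_transport_perturb_cols:
  assumes X: "X \<in> rank_one_transport l u l' u' L U" and l': "\<And>j. 0 \<le> l' $ j"
    and "j \<noteq> k"
    and j: "l' $ j < col_sum X j" "col_sum X j < u' $ j"
    and k: "l' $ k < col_sum X k" "col_sum X k < u' $ k"
  obtains D where "D \<noteq> 0" "X + D \<in> rank_one_transport l u l' u' L U"
    "X - D \<in> rank_one_transport l u l' u' L U"
proof -
  let ?T = "rank_one_transport l u l' u' L U"
  define s where "s = total_sum X"
  define a where "a = row_sum X"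
  define b where "b = col_sum X"
  have nn: "0 \<le> X $ i $ j" for i j
    using X by (auto simp: mem_rank_one_transport_iff)
  have bounds: "l $ i \<le> a i \<and> a i \<le> u $ i" "l' $ m \<le> b m \<and> b m \<le> u' $ m" "L \<le> s \<and> s \<le> U" for i m
    using X by (auto simp: mem_rank_one_transport_iff a_def b_def s_def)
  have a0: "0 \<le> a i" for i
    using nn by (simp add: a_def row_sum_def sum_nonneg)
  have suma: "(\<Sum>i\<in>UNIV. a i) = s" and sumb: "(\<Sum>m\<in>UNIV. b m) = s"
    by (simp_all add: a_def b_def s_def sum_row_sum sum_col_sum)
  have b0: "0 \<le> b m" for m
    using bounds(2) l' by (meson order_trans)
  have "0 < b j"
    using j l'[of j] by (simp add: b_def)
  then have "s \<noteq> 0"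
    using sumb b0 by (metis UNIV_I finite less_irrefl sum_nonneg_eq_0_iff)
  obtain e where e: "0 < e" "l' $ j \<le> b j - e" "b j + e \<le> u' $ j" "l' $ k \<le> b k - e" "b k + e \<le> u' $ k"
  proof
    let ?e = "min (min (b j - l' $ j) (u' $ j - b j)) (min (b k - l' $ k) (u' $ k - b k))"
    show "0 < ?e" "l' $ j \<le> b j - ?e" "b j + ?e \<le> u' $ j" "l' $ k \<le> b k - ?e" "b k + ?e \<le> u' $ k"
      using j k by (auto simp: b_def)
  qed
  define d where "d m = (if m = j then e else 0) - (if m = k then e else 0)" for m
  define D where "D = outer s a d"
  have sumd: "(\<Sum>m\<in>UNIV. d m) = 0"
    by (simp add: d_def sum_subtractf)
  have "X = outer s a b"
    using rank_one_transport_eq_outer[OF X] by (simp add: s_def a_def b_def)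
  then have XD: "X + D = outer s a (\<lambda>m. b m + d m)" "X - D = outer s a (\<lambda>m. b m - d m)"
    by (simp_all add: D_def outer_def vec_eq_iff add_divide_distrib diff_divide_distrib algebra_simps)
  have bd: "l' $ m \<le> b m + d m \<and> b m + d m \<le> u' $ m" "l' $ m \<le> b m - d m \<and> b m - d m \<le> u' $ m" for m
    using e \<open>j \<noteq> k\<close> bounds(2)[of m] by (auto simp: d_def)
  have bd0: "0 \<le> b m + d m" "0 \<le> b m - d m" for m
    using bd[of m] l'[of m] by linarith+
  have "X + D \<in> ?T"
    unfolding XD using a0 bounds bd bd0 suma sumb sumd
    by (intro outer_mem_rank_one_transport) (auto simp: sum.distrib)
  moreover have "X - D \<in> ?T"
    unfolding XD using a0 bounds bd bd0 suma sumb sumd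
    by (intro outer_mem_rank_one_transport) (auto simp: sum_subtractf)
  \<comment> \<open>If \<open>D\<close> vanished, its column \<open>j\<close> would force all row
    sums to be 0, although their total \<open>s\<close> is nonzero.\<close>
  moreover have "D \<noteq> 0"
  proof
    assume "D = 0"
    then have "D $ i $ j = 0" for i
      by simp
    then have "a i * d j / s = 0" for i
      unfolding D_def outer_def vec_lambda_beta .
    then have "a i = 0" for i
      using \<open>s \<noteq> 0\<close> e(1) \<open>j \<noteq> k\<close> by (simp add: d_def)
    then show False
      using suma \<open>s \<noteq> 0\<close> by simp
  qed
  ultimately show thesis
    using that by blast
qed

lemma not_extreme_midpoint:
  fixes X D :: "'a::real_vector"
  assumes "D \<noteq> 0" "X + D \<in> S" "X - D \<in> S"
  shows "\<not> X extreme_point_of S"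
proof
  assume "X extreme_point_of S"
  then have "X \<notin> open_segment (X - D) (X + D)"
    using assms by (simp add: extreme_point_of_def)
  moreover have "X \<in> open_segment (X - D) (X + D)"
  proof -
    have "X = midpoint (X - D) (X + D)"
      by (simp add: midpoint_def)
    then show ?thesis
      using assms(1) midpoint_in_open_segment[of "X - D" "X + D"]
      by (simp add: eq_neg_iff_add_eq_0 neg_eq_iff_add_eq_0 flip: scaleR_2)
  qed
  ultimately show False
    by simp
qed

section \<open>Arcs containing the extreme points\<close>

text \<open>This is the candidate vector of sums at an extreme point: \<open>\<sigma>\<close>
  selects the upper bounds, and position \<open>i0\<close> takes the remainder that makes the total
  \<open>s\<close>. The remainder may violate its own bounds.\<close>

definition vertex_sums :: "real^'n \<Rightarrow> real^'n \<Rightarrow> 'n \<Rightarrow> 'n set \<Rightarrow> real \<Rightarrow> 'n \<Rightarrow> real" where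
  "vertex_sums l u i0 \<sigma> s i =
     (if i = i0 then s - (\<Sum>k\<in>UNIV - {i0}. if k \<in> \<sigma> then u $ k else l $ k)
      else if i \<in> \<sigma> then u $ i else l $ i)"

lemma sum_vertex_sums: "(\<Sum>i\<in>UNIV. vertex_sums l u i0 \<sigma> s i) = s"
proof -
  have "(\<Sum>i\<in>UNIV. vertex_sums l u i0 \<sigma> s i) =
      vertex_sums l u i0 \<sigma> s i0 + (\<Sum>i\<in>UNIV - {i0}. vertex_sums l u i0 \<sigma> s i)"
    by (rule sum.remove) simp_all
  also have "(\<Sum>i\<in>UNIV - {i0}. vertex_sums l u i0 \<sigma> s i) =
      (\<Sum>k\<in>UNIV - {i0}. if k \<in> \<sigma> then u $ k else l $ k)"
    by (rule sum.cong) (auto simp: vertex_sums_def)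
  finally show ?thesis
    by (simp add: vertex_sums_def)
qed

lemma vertex_sums_eq:
  assumes "\<And>i. i \<noteq> i0 \<Longrightarrow> a i = l $ i \<or> a i = u $ i"
  shows "vertex_sums l u i0 {i. a i = u $ i} (\<Sum>i\<in>UNIV. a i) = a"
proof
  fix i
  have "(\<Sum>k\<in>UNIV - {i0}. if k \<in> {i. a i = u $ i} then u $ k else l $ k) = (\<Sum>k\<in>UNIV - {i0}. a k)"
    using assms by (intro sum.cong) (auto, metis)
  moreover have "(\<Sum>i\<in>UNIV. a i) = a i0 + (\<Sum>k\<in>UNIV - {i0}. a k)"
    by (rule sum.remove) simp_all
  ultimately show "vertex_sums l u i0 {i. a i = u $ i} (\<Sum>i\<in>UNIV. a i) i = a i"
    using assms[of i] by (auto simp: vertex_sums_def)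
qed

text \<open>Bounds are imposed only on the remainders at \<open>i0\<close> and \<open>j0\<close>,
  since all other sums equal one of their bounds. The index ranges over a finite type, so there are
  finitely many arcs.\<close>

definition vertex_arc ::
  "real^'m \<Rightarrow> real^'m \<Rightarrow> real^'n \<Rightarrow> real^'n \<Rightarrow> real \<Rightarrow> real \<Rightarrow> ('m \<times> 'n) \<times> 'm set \<times> 'n set \<Rightarrow> (real^'n^'m) set"
  where
  "vertex_arc l u l' u' L U = (\<lambda>((i0, j0), \<sigma>, \<tau>).
    {outer s (vertex_sums l u i0 \<sigma> s) (vertex_sums l' u' j0 \<tau> s) | s.
       L \<le> s \<and> s \<le> U \<and>
       l $ i0 \<le> vertex_sums l u i0 \<sigma> s i0 \<and> vertex_sums l u i0 \<sigma> s i0 \<le> u $ i0 \<and>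
       l' $ j0 \<le> vertex_sums l' u' j0 \<tau> s j0 \<and> vertex_sums l' u' j0 \<tau> s j0 \<le> u' $ j0})"

lemma vertex_arc_subset:
  assumes "\<And>i. 0 \<le> l $ i" "\<And>j. 0 \<le> l' $ j" "\<And>i. l $ i \<le> u $ i" "\<And>j. l' $ j \<le> u' $ j"
  shows "vertex_arc l u l' u' L U v \<subseteq> rank_one_transport l u l' u' L U"
proof
  fix X assume "X \<in> vertex_arc l u l' u' L U v"
  then obtain i0 j0 \<sigma> \<tau> s where
    X: "X = outer s (vertex_sums l u i0 \<sigma> s) (vertex_sums l' u' j0 \<tau> s)"
    and s: "L \<le> s" "s \<le> U"
    and i0: "l $ i0 \<le> vertex_sums l u i0 \<sigma> s i0" "vertex_sums l u i0 \<sigma> s i0 \<le> u $ i0"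
    and j0: "l' $ j0 \<le> vertex_sums l' u' j0 \<tau> s j0" "vertex_sums l' u' j0 \<tau> s j0 \<le> u' $ j0"
    by (auto simp: vertex_arc_def split: prod.splits)
  have row: "l $ i \<le> vertex_sums l u i0 \<sigma> s i \<and> vertex_sums l u i0 \<sigma> s i \<le> u $ i" for i
    using i0 assms(3) by (cases "i = i0") (auto simp: vertex_sums_def)
  have col: "l' $ j \<le> vertex_sums l' u' j0 \<tau> s j \<and> vertex_sums l' u' j0 \<tau> s j \<le> u' $ j" for j
    using j0 assms(4) by (cases "j = j0") (auto simp: vertex_sums_def)
  show "X \<in> rank_one_transport l u l' u' L U"
    unfolding X
  proof (rule outer_mem_rank_one_transport)
    show "0 \<le> vertex_sums l u i0 \<sigma> s i \<and> l $ i \<le> vertex_sums l u i0 \<sigma> s i \<and>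
        vertex_sums l u i0 \<sigma> s i \<le> u $ i" for i
      using row assms(1) order_trans by blast
    show "0 \<le> vertex_sums l' u' j0 \<tau> s j \<and> l' $ j \<le> vertex_sums l' u' j0 \<tau> s j \<and>
        vertex_sums l' u' j0 \<tau> s j \<le> u' $ j" for j
      using col assms(2) order_trans by blast
  qed (use s in \<open>auto simp: sum_vertex_sums\<close>)
qed

text \<open>Both vectors of sums are affine in \<open>s\<close>. Their product divided by
  \<open>s\<close> has a constant term, a multiple of \<open>s\<close> and a multiple of
  \<open>1 / s\<close>.\<close>

lemma hyperbola_arc_vertex_arc:
  assumes "\<And>i. 0 \<le> l $ i" "\<And>j. 0 \<le> l' $ j" "\<And>i. 0 \<le> u $ i" "\<And>j. 0 \<le> u' $ j"
  shows "hyperbola_arc (vertex_arc l u l' u' L U v)"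
proof -
  obtain i0 j0 \<sigma> \<tau> where v: "v = ((i0, j0), \<sigma>, \<tau>)"
    by (metis prod.exhaust)
  define c where "c k = (if k \<in> \<sigma> then u $ k else l $ k)" for k
  define c' where "c' k = (if k \<in> \<tau> then u' $ k else l' $ k)" for k
  define A where "A = (\<Sum>k\<in>UNIV - {i0}. c k)"
  define B where "B = (\<Sum>k\<in>UNIV - {j0}. c' k)"
  have c0: "0 \<le> c k" "0 \<le> c' m" for k m
    using assms by (auto simp: c_def c'_def)
  define e where "e i = (if i = i0 then 1 else 0::real)" for i
  define f where "f j = (if j = j0 then 1 else 0::real)" for j
  define \<alpha> where "\<alpha> i = (if i = i0 then - A else c i)" for i
  define \<beta> where "\<beta> j = (if j = j0 then - B else c' j)" for j
  have sums: "vertex_sums l u i0 \<sigma> s = (\<lambda>i. \<alpha> i + s * e i)" "vertex_sums l' u' j0 \<tau> s = (\<lambda>j. \<beta> j + s * f j)" for s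
    by (auto simp: vertex_sums_def \<alpha>_def \<beta>_def e_def f_def A_def B_def c_def c'_def fun_eq_iff)
  \<comment> \<open>The bounds on the two remainders, solved for \<open>s\<close>, are intersected
    with \<open>L\<close> and \<open>U\<close> into one interval.\<close>
  define p where "p = max L (max (l $ i0 + A) (l' $ j0 + B))"
  define q where "q = min U (min (u $ i0 + A) (u' $ j0 + B))"
  have arc: "vertex_arc l u l' u' L U v = (\<lambda>s. outer s (\<lambda>i. \<alpha> i + s * e i) (\<lambda>j. \<beta> j + s * f j)) ` {p..q}"
    unfolding v vertex_arc_def prod.case sums
    by (auto simp: \<alpha>_def \<beta>_def e_def f_def p_def q_def)
  define Q where "Q = (\<chi> i j. e i * f j)"
  show ?thesis
  proof (cases "0 < p")
    case True
    define P where "P = (\<chi> i j. \<alpha> i * f j + e i * \<beta> j)"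
    define R where "R = (\<chi> i j. \<alpha> i * \<beta> j)"
    have "outer s (\<lambda>i. \<alpha> i + s * e i) (\<lambda>j. \<beta> j + s * f j) = P + s *\<^sub>R Q + (1 / s) *\<^sub>R R" if "s \<in> {p..q}" for s
      using that True by (auto simp: outer_def P_def Q_def R_def vec_eq_iff field_simps)
    then have "vertex_arc l u l' u' L U v = (\<lambda>s. P + s *\<^sub>R Q + (1 / s) *\<^sub>R R) ` {p..q}"
      unfolding arc by (intro image_cong) auto
    then show ?thesis
      unfolding hyperbola_arc_def using True by blast
  next
    case False
    \<comment> \<open>When \<open>p\<close> is not positive, nonnegativity makes all fixed sums 0.
      Then only the entry at (i0, j0) can be nonzero, and the arc is a segment of multiples of
      \<open>Q\<close>.\<close>
    have "0 \<le> A" "0 \<le> B"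
      using c0 by (auto simp: A_def B_def intro: sum_nonneg)
    then have AB: "A = 0" "B = 0"
      using False assms(1)[of i0] assms(2)[of j0] by (auto simp: p_def)
    have "\<alpha> i = 0" "\<beta> j = 0" for i j
      using AB c0 by (auto simp: \<alpha>_def \<beta>_def A_def B_def sum_nonneg_eq_0_iff)
    then have "vertex_arc l u l' u' L U v = (\<lambda>s. s *\<^sub>R Q) ` {p..q}"
      unfolding arc by (intro image_cong) (auto simp: outer_def Q_def vec_eq_iff)
    \<comment> \<open>The parameter is shifted by 1 since an arc must stay away from 0.\<close>
    also have "\<dots> = (\<lambda>s. - Q + s *\<^sub>R Q + (1 / s) *\<^sub>R 0) ` (\<lambda>s. s + 1) ` {p..q}"
      unfolding image_image by (intro image_cong) (simp_all add: scaleR_add_left)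
    also have "(\<lambda>s. s + 1) ` {p..q} = {p + 1..q + 1}"
      by simp
    finally have "vertex_arc l u l' u' L U v = (\<lambda>s. - Q + s *\<^sub>R Q + (1 / s) *\<^sub>R 0) ` {p + 1..q + 1}" .
    moreover have "0 < p + 1"
      using \<open>0 \<le> A\<close> assms(1)[of i0] by (auto simp: p_def)
    ultimately show ?thesis
      unfolding hyperbola_arc_def by blast
  qed
qed

lemma extreme_point_mem_vertex_arc:
  assumes l: "\<And>i. 0 \<le> l $ i" and l': "\<And>j. 0 \<le> l' $ j"
    and ext: "X extreme_point_of convex hull (rank_one_transport l u l' u' L U)"
  obtains v where "X \<in> vertex_arc l u l' u' L U v"
proof -
  let ?T = "rank_one_transport l u l' u' L U"
  have X: "X \<in> ?T"
    using ext by (rule extreme_point_of_convex_hull)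
  \<comment> \<open>Such a \<open>D\<close> would make \<open>X\<close> the midpoint of two distinct
    points of the hull.\<close>
  have noD: False if "D \<noteq> 0" "X + D \<in> ?T" "X - D \<in> ?T" for D
    using not_extreme_midpoint[OF that(1), of X "convex hull ?T"] that ext by (meson hull_inc)
  have bounds: "l $ i \<le> row_sum X i" "row_sum X i \<le> u $ i" "l' $ j \<le> col_sum X j" "col_sum X j \<le> u' $ j"
    "L \<le> total_sum X" "total_sum X \<le> U" for i j
    using X by (auto simp: mem_rank_one_transport_iff)
  have "\<exists>j0. \<forall>j. j \<noteq> j0 \<longrightarrow> col_sum X j = l' $ j \<or> col_sum X j = u' $ j"
  proof (rule ccontr)
    assume *: "\<not> ?thesis"
    then obtain j where j: "col_sum X j \<noteq> l' $ j" "col_sum X j \<noteq> u' $ j"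
      by blast
    \<comment> \<open>Taking the column \<open>j\<close> just found as the exceptional one produces
      a second column strictly between its bounds.\<close>
    from * obtain k where k: "k \<noteq> j" "col_sum X k \<noteq> l' $ k" "col_sum X k \<noteq> u' $ k"
      by blast
    show False
      by (rule rank_one_transport_perturb_cols[OF X l', of j k])
        (use j k bounds noD in \<open>auto simp: less_le\<close>)
  qed
  then obtain j0 where j0: "\<And>j. j \<noteq> j0 \<Longrightarrow> col_sum X j = l' $ j \<or> col_sum X j = u' $ j"
    by blast
  have "\<exists>i0. \<forall>i. i \<noteq> i0 \<longrightarrow> row_sum X i = l $ i \<or> row_sum X i = u $ i"
  proof (rule ccontr)
    assume *: "\<not> ?thesis"
    have tr: "col_sum (transpose X) i = row_sum X i" for i
      by (simp add: col_sum_def row_sum_def transpose_def)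
    from * obtain j where j: "row_sum X j \<noteq> l $ j" "row_sum X j \<noteq> u $ j"
      by blast
    from * obtain k where k: "k \<noteq> j" "row_sum X k \<noteq> l $ k" "row_sum X k \<noteq> u $ k"
      by blast
    obtain D where D: "D \<noteq> 0" "transpose X + D \<in> rank_one_transport l' u' l u L U"
      "transpose X - D \<in> rank_one_transport l' u' l u L U"
      by (rule rank_one_transport_perturb_cols[OF transpose_mem_rank_one_transport[OF X] l, of j k])
        (use j k bounds in \<open>auto simp: less_le tr\<close>)
    have "transpose (transpose X + D) = X + transpose D" "transpose (transpose X - D) = X - transpose D"
      by (simp_all add: transpose_def vec_eq_iff)
    moreover have "transpose D \<noteq> 0"
      using D(1) by (auto simp: transpose_def vec_eq_iff)
    ultimately show False
      using noD[of "transpose D"] transpose_mem_rank_one_transport[OF D(2)]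
        transpose_mem_rank_one_transport[OF D(3)] by simp
  qed
  then obtain i0 where i0: "\<And>i. i \<noteq> i0 \<Longrightarrow> row_sum X i = l $ i \<or> row_sum X i = u $ i"
    by blast
  \<comment> \<open>The selected set consists of the rows at their upper bound; every other row
    except possibly \<open>i0\<close> is at its lower bound.\<close>
  have row: "vertex_sums l u i0 {i. row_sum X i = u $ i} (total_sum X) = row_sum X"
    using vertex_sums_eq[of i0 "row_sum X" l u] i0 by (simp add: sum_row_sum)
  have col: "vertex_sums l' u' j0 {j. col_sum X j = u' $ j} (total_sum X) = col_sum X"
    using vertex_sums_eq[of j0 "col_sum X" l' u'] j0 by (simp add: sum_col_sum)
  have "X \<in> vertex_arc l u l' u' L U ((i0, j0), {i. row_sum X i = u $ i}, {j. col_sum X j = u' $ j})"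
    unfolding vertex_arc_def prod.case mem_Collect_eq
    by (rule exI[of _ "total_sum X"])
      (use bounds rank_one_transport_eq_outer[OF X] in \<open>simp add: row col\<close>)
  then show thesis
    by (rule that)
qed

theorem theorem1:
  fixes l u :: "real^'m" and l' u' :: "real^'n" and L U :: real
  assumes "\<forall>i. 0 \<le> l $ i" and "\<forall>i. 0 \<le> u $ i"
    and "\<forall>j. 0 \<le> l' $ j" and "\<forall>j. 0 \<le> u' $ j"
    and "0 \<le> L" and "0 \<le> U"
    and "\<forall>i. l $ i \<le> u $ i" and "\<forall>j. l' $ j \<le> u' $ j" and "L \<le> U"
    and "\<forall>i. 0 < u $ i" and "\<forall>j. 0 < u' $ j"
  shows "soc_representable (convex hull (rank_one_transport l u l' u' L U))"
proof -
  let ?T = "rank_one_transport l u l' u' L U"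
  let ?V = "\<Union>v\<in>UNIV. vertex_arc l u l' u' L U v"
  have "convex hull ?T = convex hull {X. X extreme_point_of convex hull ?T}"
    by (intro Krein_Milman_Minkowski compact_convex_hull compact_rank_one_transport convex_convex_hull)
  also have "\<dots> \<subseteq> convex hull ?V"
    using assms by (intro hull_mono) (blast elim: extreme_point_mem_vertex_arc[rotated 2])
  finally have "convex hull ?T \<subseteq> convex hull ?V" .
  moreover have "convex hull ?V \<subseteq> convex hull ?T"
    using assms by (intro hull_mono UN_least vertex_arc_subset) auto
  ultimately have "convex hull ?T = convex hull ?V"
    by (rule antisym)
  moreover have "soc_representable (convex hull ?V)"
    using assms by (intro soc_representable_convex_hull_hyperbola_arcs hyperbola_arc_vertex_arc) auto
  ultimately show ?thesis
    by simp
qed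

end
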